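(* The family of nanoscopic sets is not an ideal, i.e., there are two nanoscopic sets $A,B\subseteq\mathbb{R}$ such that their union $A\cup B$ is not nanoscopic.
   Context: $\omega=\{0,1,2,\ldots\}$; $|J|$ denotes the length of an interval $J\subseteq\mathbb{R}$. A set $M\subseteq\mathbb{R}$ is called nanoscopic if for any $\varepsilon>0$ there exists a sequence of intervals $(I_k)_{k\in\omega}$ such that $M\subseteq\bigcup_k I_k$ and $|I_k|\le\varepsilon^{2^k}$ for all $k\in\omega$. *)

theory Defs
  imports "HOL-Analysis.Analysis"
begin

text \<open>
  The length is extended-valued, so that an unbounded interval has length
  \<open>\<infinity>\<close>; the real-valued \<open>measure lborel\<close> would give it length \<open>0\<close>.
  It is only ever applied to intervals.
\<close>

definition interval_length :: "real set \<Rightarrow> ennreal" where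
  "interval_length J = emeasure lborel J"

text \<open>
  Intervals of every kind are allowed: open, closed, half-open, degenerate, empty.
\<close>

definition nanoscopic :: "real set \<Rightarrow> bool" where
  "nanoscopic M \<longleftrightarrow>
     (\<forall>\<epsilon>::real. \<epsilon> > 0 \<longrightarrow>
        (\<exists>I :: nat \<Rightarrow> real set.
           (\<forall>k. is_interval (I k)) \<and>
           M \<subseteq> (\<Union>k. I k) \<and>
           (\<forall>k. interval_length (I k) \<le> ennreal (\<epsilon> ^ (2 ^ k)))))"

text \<open>
  Ideals of subsets of a type. Properness (\<open>UNIV \<notin> \<F>\<close>) is not required, which makes
  the negation of this predicate the stronger of the two possible claims.
\<close>

definition ideal_of_sets :: "'a set set \<Rightarrow> bool" where
  "ideal_of_sets \<F> \<longleftrightarrow>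
     {} \<in> \<F> \<and>
     (\<forall>A B. B \<in> \<F> \<longrightarrow> A \<subseteq> B \<longrightarrow> A \<in> \<F>) \<and>
     (\<forall>A B. A \<in> \<F> \<longrightarrow> B \<in> \<F> \<longrightarrow> A \<union> B \<in> \<F>)"

end

theory Submission
  imports Defs
begin

text \<open>
  Both sets are limit superiors of closed intervals \<open>J l\<close> of length \<open>r ^ 2 ^ l\<close> with
  \<open>r = 1/100\<close>; such a set is covered by each tail \<open>(J l)\<^bsub>l \<ge> m\<^esub>\<close>, hence nanoscopic.
  The intervals form a tree: the indices in \<open>[10 ^ i, 10 ^ Suc i)\<close> are equally spaced
  children of one earlier node, and if \<open>i\<close> encodes the pair \<open>(s, t)\<close>, that parent is \<open>s\<close> for
  the set \<open>A\<close> and \<open>t\<close> for the set \<open>B\<close>, which lies far away from \<open>A\<close>.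

  Let intervals \<open>I k\<close> satisfy \<open>|I k| \<le> r ^ 2 ^ Suc k\<close>, and let \<open>s\<close> and \<open>t\<close> be nodes of the two
  trees that are disjoint from all \<open>I k\<close> with \<open>k < s\<close> and \<open>k < t\<close>, respectively. With
  \<open>N = 10 ^ i\<close>, the two nodes have \<open>18 N\<close> children in block \<open>i\<close>. The \<open>I k\<close> with
  \<open>N \<le> k < 10 N\<close> are so short that each meets at most one of these children, and by total
  length those with \<open>k < N\<close> meet fewer than \<open>5 N\<close>, so some child is disjoint from
  all \<open>I k\<close> with \<open>k < 10 N\<close>. Hence either every such node \<open>s\<close> has such a child, or every such
  node \<open>t\<close> has one; a branch of the respective tree then ends in a point outside all \<open>I k\<close>.
\<close>

definition len :: "nat \<Rightarrow> real" where
  "len k = (1/100) ^ (2 ^ k)"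

text \<open>The number of decimal digits of \<open>l\<close>, minus one. The root 0 lies in no block
  and gets the value 0.\<close>

definition block :: "nat \<Rightarrow> nat" where
  "block l = (LEAST i. l < 10 ^ Suc i)"

text \<open>
  For parent functions with \<open>p i \<le> i\<close> the guard fails only at \<open>l = 0\<close>, the root;
  for other \<open>p\<close> it merely enforces termination.
\<close>

function left_end :: "(nat \<Rightarrow> nat) \<Rightarrow> real \<Rightarrow> nat \<Rightarrow> real" where
  "left_end p c l =
     (if p (block l) < l
      then left_end p c (p (block l)) +
           real (l - 10 ^ block l) * (len (p (block l)) / (9 * 10 ^ block l))
      else c)"
  by auto
termination by (relation "Wellfounded.measure (\<lambda>(p, c, l). l)") auto

declare left_end.simps [simp del]

definition node :: "(nat \<Rightarrow> nat) \<Rightarrow> real \<Rightarrow> nat \<Rightarrow> real set" where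
  "node p c l = {left_end p c l .. left_end p c l + len l}"

definition branches :: "(nat \<Rightarrow> nat) \<Rightarrow> real \<Rightarrow> real set" where
  "branches p c = {x. \<exists>\<^sub>\<infinity>l. x \<in> node p c l}"

definition hits :: "(nat \<Rightarrow> nat) \<Rightarrow> real \<Rightarrow> nat \<Rightarrow> real set \<Rightarrow> nat set" where
  "hits p c i J = {l \<in> {10 ^ i..<10 ^ Suc i}. node p c l \<inter> J \<noteq> {}}"

text \<open>Only \<open>k < s\<close> is required: the root qualifies vacuously, and later intervals
  are left to descendants of larger index.\<close>

definition avoids :: "(nat \<Rightarrow> real set) \<Rightarrow> (nat \<Rightarrow> nat) \<Rightarrow> real \<Rightarrow> nat \<Rightarrow> bool" where
  "avoids I p c s \<longleftrightarrow> (\<forall>k<s. node p c s \<inter> I k = {})"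

section \<open>Lengths of the nodes\<close>

lemma len_pos: "len k > 0"
  by (simp add: len_def)

lemma len_Suc: "len (Suc k) = len k * len k"
  by (simp add: len_def power_add [symmetric] mult_2)

lemma len_le: "len k \<le> 1/100"
  using power_decreasing [of 1 "2 ^ k" "1/100 :: real"] by (simp add: len_def)

lemma len_Suc_le: "100 * len (Suc k) \<le> len k"
  using mult_left_mono [OF len_le [of k], of "len k"] len_pos [of k]
  by (simp add: len_Suc)

lemma len_antimono: "k \<le> l \<Longrightarrow> len l \<le> len k"
  by (simp add: len_def power_decreasing)

text \<open>By \<open>len_Suc_le\<close>, \<open>99 * len (Suc k)\<close> is at most
  \<open>len k - len (Suc k)\<close>, and these differences telescope.\<close>

lemma sum_len_le: "s \<le> n \<Longrightarrow> 99 * (\<Sum>k=s..<n. len (Suc k)) \<le> len s - len n"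
proof (induction n rule: dec_induct)
  case (step n)
  then show ?case using len_Suc_le [of n] by (simp add: algebra_simps)
qed simp

lemma Suc_mult_len_le: "real (Suc M) * len M \<le> 1/100"
proof (induction M)
  case 0
  then show ?case by (simp add: len_def)
next
  case (Suc M)
  have "real (Suc (Suc M)) * (100 * len (Suc M)) \<le> real (100 * Suc M) * len M"
    using len_Suc_le [of M] len_pos[of "Suc M"] by (intro mult_mono) auto
  also have "\<dots> = 100 * (real (Suc M) * len M)" by simp
  also have "\<dots> \<le> 1" using Suc by simp
  finally show ?case by (simp only: mult.left_commute)
qed

text \<open>For \<open>N = Suc M\<close>, \<open>len N\<close> is the square of
  \<open>len M\<close>: one factor absorbs \<open>N\<close>, the other is at most
  \<open>len s\<close>.\<close>

lemma mult_len_le: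
  assumes "s < N"
  shows "real N * len N \<le> len s / 100"
proof -
  from assms obtain M where M: "N = Suc M" "s \<le> M"
    by (metis less_eq_Suc_le Suc_le_D Suc_le_mono)
  have "real N * len N = (real (Suc M) * len M) * len M"
    by (simp add: M len_Suc)
  also have "\<dots> \<le> 1/100 * len s"
    using Suc_mult_len_le [of M] len_antimono [OF M(2)] len_pos [of M]
    by (intro mult_mono) auto
  finally show ?thesis by simp
qed

section \<open>Blocks of indices and nesting of nodes\<close>

lemma block_eq:
  assumes "l \<in> {10 ^ i..<10 ^ Suc i}"
  shows "block l = i"
  unfolding block_def
proof (rule Least_equality)
  fix j assume "l < 10 ^ Suc j"
  with assms have "(10::nat) ^ i < 10 ^ Suc j" by auto
  then have "i < Suc j" by (rule power_less_imp_less_exp [rotated]) simp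
  then show "i \<le> j" by simp
qed (use assms in auto)

lemma less_pow10: "i < (10::nat) ^ i"
  by (rule less_exp [THEN less_le_trans]) (simp add: power_mono)

lemma left_end_child:
  assumes "p i \<le> i" "l \<in> {10 ^ i..<10 ^ Suc i}"
  shows "left_end p c l = left_end p c (p i) + real (l - 10 ^ i) * (len (p i) / (9 * 10 ^ i))"
proof -
  have "p i < l" using assms less_pow10 [of i] by auto
  then show ?thesis
    by (subst left_end.simps) (simp add: block_eq [OF assms(2)])
qed

text \<open>The factor \<open>len s / (9 * 10 ^ i)\<close> is the spacing of the children of
  \<open>s\<close> in block \<open>i\<close>; they fill at most 9/100 of it, leaving wide
  gaps.\<close>

lemma len_child:
  assumes "s \<le> i"
  shows "len (10 ^ i) \<le> 9/100 * (len s / (9 * 10 ^ i))"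
proof -
  have "s < 10 ^ i" using assms less_pow10 [of i] by simp
  from mult_len_le [OF this] show ?thesis by (simp add: field_simps)
qed

text \<open>The parent is cut into \<open>9 * 10 ^ i\<close> slots of length \<open>S\<close>; each
  child starts at the left end of its slot and is no longer than \<open>S\<close>.\<close>

lemma node_child_subset:
  assumes "p i \<le> i" "l \<in> {10 ^ i..<10 ^ Suc i}"
  shows "node p c l \<subseteq> node p c (p i)"
proof -
  define S where "S = len (p i) / (9 * 10 ^ i)"
  have S: "S > 0" "9 * 10 ^ i * S = len (p i)" by (simp_all add: S_def len_pos)
  have "len l \<le> len (10 ^ i)" using assms by (intro len_antimono) auto
  also have "\<dots> \<le> S" using len_child [OF assms(1)] S(1) by (simp add: S_def[symmetric])
  finally have "real (l - 10 ^ i) * S + len l \<le> real (Suc (l - 10 ^ i)) * S"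
    by (simp add: algebra_simps)
  also have "\<dots> \<le> real (9 * 10 ^ i) * S"
  proof (intro mult_right_mono of_nat_mono)
    show "Suc (l - 10 ^ i) \<le> 9 * 10 ^ i" using assms(2) by auto
  qed (use S(1) in simp)
  also have "\<dots> = len (p i)" using S(2) by simp
  finally have *: "real (l - 10 ^ i) * S + len l \<le> len (p i)" .
  have "0 \<le> real (l - 10 ^ i) * S" using S(1) by simp
  with * show ?thesis
    unfolding node_def left_end_child [of p i, OF assms] S_def [symmetric] by auto
qed

lemma block_bounds:
  assumes "l > 0"
  shows "l \<in> {10 ^ block l..<10 ^ Suc (block l)}"
proof -
  have "l < 10 ^ Suc l" using less_pow10 [of "Suc l"] by linarith
  then have "l < 10 ^ Suc (block l)" unfolding block_def by (rule LeastI)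
  moreover have "10 ^ block l \<le> l"
  proof (cases "block l")
    case (Suc j)
    then have "\<not> l < 10 ^ Suc j" unfolding block_def by (intro not_less_Least) simp
    then show ?thesis using Suc by simp
  qed (use assms in simp)
  ultimately show ?thesis by simp
qed

text \<open>Every index \<open>l > 0\<close> has a parent of smaller index, so the bound passes down
  from the root. With \<open>c\<close> equal to 0 and 10 it separates the two trees.\<close>

lemma node_subset_root:
  assumes "\<And>i. p i \<le> i"
  shows "node p c l \<subseteq> {c..c + 1/100}"
proof (induction l rule: less_induct)
  case (less l)
  show ?case
  proof (cases "l = 0")
    case True
    then have "left_end p c l = c" by (subst left_end.simps) simp
    then show ?thesis using len_le [of l] by (simp add: node_def)
  next
    case False
    then have l: "l \<in> {10 ^ block l..<10 ^ Suc (block l)}" by (intro block_bounds) simp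
    with assms [of "block l"] less_pow10 [of "block l"] have "p (block l) < l" by auto
    from less [OF this] node_child_subset [of p "block l" l c, OF assms l] show ?thesis by blast
  qed
qed

section \<open>Counting the children that one interval meets\<close>

lemma hits_diff_le:
  assumes "p i \<le> i" and l: "l \<in> hits p c i J" "l' \<in> hits p c i J" "l \<le> l'"
    and diam: "\<And>x y. x \<in> J \<Longrightarrow> y \<in> J \<Longrightarrow> y - x \<le> d"
  shows "real l' - real l \<le> d / (len (p i) / (9 * 10 ^ i)) + 9/100"
proof -
  define S where "S = len (p i) / (9 * 10 ^ i)"
  have S: "S > 0" by (simp add: S_def len_pos)
  have ll: "l \<in> {10 ^ i..<10 ^ Suc i}" "l' \<in> {10 ^ i..<10 ^ Suc i}"
    using l by (auto simp: hits_def)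
  obtain x y where xy: "x \<in> node p c l" "x \<in> J" "y \<in> node p c l'" "y \<in> J"
    using l unfolding hits_def by blast
  have "len l \<le> 9/100 * S"
    using len_antimono [of "10 ^ i" l] len_child [OF assms(1)] ll by (simp add: S_def)
  moreover have "left_end p c l' - left_end p c l = (real l' - real l) * S"
    using ll by (simp add: left_end_child [of p i, OF assms(1)] S_def [symmetric] algebra_simps)
  \<comment> \<open>\<open>x\<close> is at most \<open>len l\<close> beyond the left end of node
    \<open>l\<close>, and \<open>y\<close> is not before the left end of node
    \<open>l'\<close>.\<close>
  ultimately have "(real l' - real l) * S \<le> d + 9/100 * S"
    using xy diam [of x y] by (auto simp: node_def)
  then have "real l' - real l \<le> (d + 9/100 * S) / S" using S by (simp add: field_simps)
  also have "\<dots> = d / S + 9/100" using S by (simp add: field_simps)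
  finally show ?thesis by (simp add: S_def)
qed

lemma finite_hits: "finite (hits p c i J)"
  by (simp add: hits_def)

lemma card_le_diameter:
  fixes F :: "nat set"
  assumes "finite F" "b \<ge> 0" and b: "\<And>l l'. l \<in> F \<Longrightarrow> l' \<in> F \<Longrightarrow> l \<le> l' \<Longrightarrow> real l' - real l \<le> b"
  shows "real (card F) \<le> b + 1"
proof (cases "F = {}")
  case False
  have "F \<subseteq> {Min F..Max F}" using assms(1) by auto
  then have "card F \<le> Suc (Max F) - Min F"
    using card_mono [of "{Min F..Max F}" F] by simp
  moreover have "Min F \<le> Max F" using False assms(1) by simp
  moreover have "real (Max F) - real (Min F) \<le> b"
    using False assms(1) by (intro b) auto
  ultimately show ?thesis by linarith
qed (use assms in simp)

lemma card_hits_le: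
  assumes "p i \<le> i" "d \<ge> 0" "\<And>x y. x \<in> J \<Longrightarrow> y \<in> J \<Longrightarrow> y - x \<le> d"
  shows "real (card (hits p c i J)) \<le> d / (len (p i) / (9 * 10 ^ i)) + 2"
proof -
  have "real (card (hits p c i J)) \<le> (d / (len (p i) / (9 * 10 ^ i)) + 9/100) + 1"
    using assms len_pos [of "p i"]
    by (intro card_le_diameter finite_hits hits_diff_le) (auto intro!: add_nonneg_nonneg)
  then show ?thesis by simp
qed

text \<open>The set \<open>J\<close> and the left one of two nodes each contribute at most 9/100 of
  the spacing, so indices that are hit differ by less than 1.\<close>

lemma card_hits_le_1:
  assumes "p i \<le> i" "\<And>x y. x \<in> J \<Longrightarrow> y \<in> J \<Longrightarrow> y - x \<le> len (10 ^ i)"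
  shows "card (hits p c i J) \<le> 1"
proof -
  have "len (10 ^ i) / (len (p i) / (9 * 10 ^ i)) \<le> 9/100"
    using len_child [OF assms(1)] len_pos [of "p i"] by (simp add: field_simps)
  then have "real l' - real l \<le> 18/100"
    if "l \<in> hits p c i J" "l' \<in> hits p c i J" "l \<le> l'" for l l'
    using hits_diff_le [of p i l c J l' "len (10 ^ i)", OF assms(1) that assms(2)] by simp
  then have "real (card (hits p c i J)) \<le> 18/100 + 1"
    by (intro card_le_diameter finite_hits) auto
  then show ?thesis by linarith
qed

text \<open>So short a set cannot bridge the distance between the trees, so the two counts are never
  both positive.\<close>

lemma card_hits_two_trees:
  assumes "\<And>i. p i \<le> i" "\<And>i. q i \<le> i" "\<And>x y. x \<in> J \<Longrightarrow> y \<in> J \<Longrightarrow> y - x \<le> len (10 ^ i)"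
  shows "card (hits p 0 i J) + card (hits q 10 i J) \<le> 1"
proof -
  have "hits p 0 i J = {} \<or> hits q 10 i J = {}"
  proof (rule ccontr)
    assume "\<not> ?thesis"
    then obtain l l' x y where "x \<in> node p 0 l" "x \<in> J" "y \<in> node q 10 l'" "y \<in> J"
      unfolding hits_def by blast
    then have "x \<le> 1" "y \<ge> 10" "y - x \<le> len (10 ^ i)"
      using node_subset_root [of p 0 l, OF assms(1)] node_subset_root [of q 10 l', OF assms(2)] assms(3) by auto
    then show False using len_le [of "10 ^ i"] by simp
  qed
  then show ?thesis
    using card_hits_le_1 [of p i J 0] card_hits_le_1 [of q i J 10] assms by auto
qed

section \<open>Counting over a whole block\<close>

lemma sum_hits_early:
  assumes "p i \<le> i" "avoids I p c (p i)"
    and diam: "\<And>k x y. x \<in> I k \<Longrightarrow> y \<in> I k \<Longrightarrow> y - x \<le> len (Suc k)"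
  shows "(\<Sum>k<10 ^ i. real (card (hits p c i (I k)))) \<le> (2 + 1/11) * 10 ^ i"
proof -
  define S where "S = len (p i) / (9 * 10 ^ i)"
  have le: "p i \<le> 10 ^ i" using assms(1) less_pow10 [of i] by simp
  \<comment> \<open>Children lie inside the parent, which these \<open>I k\<close> miss.\<close>
  have "hits p c i (I k) = {}" if "k < p i" for k
    using node_child_subset [of p i, OF assms(1)] assms(2) that unfolding hits_def avoids_def by blast
  then have "(\<Sum>k<10 ^ i. real (card (hits p c i (I k))))
      = (\<Sum>k=p i..<10 ^ i. real (card (hits p c i (I k))))"
    by (intro sum.mono_neutral_right) (auto simp: not_le)
  also have "\<dots> \<le> (\<Sum>k=p i..<10 ^ i. len (Suc k) / S + 2)"
    unfolding S_def using diam
    by (intro sum_mono card_hits_le assms(1)) (auto simp: len_pos less_imp_le)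
  also have "\<dots> = (\<Sum>k=p i..<10 ^ i. len (Suc k)) / S + 2 * real (10 ^ i - p i)"
    by (simp add: sum.distrib sum_divide_distrib)
  also have "\<dots> \<le> (len (p i) / 99) / S + 2 * 10 ^ i"
  proof (intro add_mono divide_right_mono)
    show "(\<Sum>k=p i..<10 ^ i. len (Suc k)) \<le> len (p i) / 99"
      using sum_len_le [OF le] len_pos [of "10 ^ i"] by simp
    show "0 \<le> S" by (simp add: S_def len_pos less_imp_le)
    show "2 * real (10 ^ i - p i) \<le> 2 * 10 ^ i" using le by (simp add: of_nat_diff)
  qed
  \<comment> \<open>The total length, at most a 99th of the parent by \<open>sum_len_le\<close>,
    measured in spacings; the 2 per interval is the rounding allowance of
    \<open>card_hits_le\<close>.\<close>
  also have "(len (p i) / 99) / S = 1/11 * 10 ^ i"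
    using len_pos [of "p i"] by (simp add: S_def field_simps)
  finally show ?thesis by (simp add: algebra_simps)
qed

lemma sum_hits_ge:
  assumes "\<And>l. l \<in> {10 ^ i..<10 ^ Suc i} \<Longrightarrow> \<not> avoids I p c l"
  shows "9 * 10 ^ i \<le> (\<Sum>k<10 ^ Suc i. card (hits p c i (I k)))"
proof -
  have "{10 ^ i..<10 ^ Suc i} \<subseteq> (\<Union>k<10 ^ Suc i. hits p c i (I k))"
  proof
    fix l :: nat assume l: "l \<in> {10 ^ i..<10 ^ Suc i}"
    from assms [OF l] obtain k where "k < l" "node p c l \<inter> I k \<noteq> {}"
      by (auto simp: avoids_def)
    with l show "l \<in> (\<Union>k<10 ^ Suc i. hits p c i (I k))"
      by (auto simp: hits_def)
  qed
  then have "card {(10::nat) ^ i..<10 ^ Suc i} \<le> card (\<Union>k<10 ^ Suc i. hits p c i (I k))"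
    by (intro card_mono finite_UN_I finite_hits) auto
  also have "\<dots> \<le> (\<Sum>k<10 ^ Suc i. card (hits p c i (I k)))"
    by (rule card_UN_le) simp
  finally show ?thesis by simp
qed

lemma avoiding_child:
  assumes "\<And>i. p i \<le> i" "\<And>i. q i \<le> i" "avoids I p 0 (p i)" "avoids I q 10 (q i)"
    and diam: "\<And>k x y. x \<in> I k \<Longrightarrow> y \<in> I k \<Longrightarrow> y - x \<le> len (Suc k)"
  shows "\<exists>l\<in>{10 ^ i..<10 ^ Suc i}. avoids I p 0 l \<or> avoids I q 10 l"
proof (rule ccontr)
  assume no: "\<not> ?thesis"
  define h where "h k = card (hits p 0 i (I k)) + card (hits q 10 i (I k))" for k
  have "18 * 10 ^ i \<le> (\<Sum>k<10 ^ Suc i. h k)"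
    using sum_hits_ge [of i I p 0] sum_hits_ge [of i I q 10] no
    by (auto simp: h_def sum.distrib)
  also have "\<dots> = (\<Sum>k<10 ^ i. h k) + (\<Sum>k=10 ^ i..<10 ^ Suc i. h k)"
    by (subst sum.union_disjoint [symmetric]) (auto intro!: sum.cong)
  \<comment> \<open>One hit per late interval: at most half of the \<open>18 * 10 ^ i\<close>
    required.\<close>
  also have "(\<Sum>k=10 ^ i..<10 ^ Suc i. h k) \<le> (\<Sum>k=(10::nat) ^ i..<10 ^ Suc i. 1)"
    unfolding h_def
  proof (intro sum_mono card_hits_two_trees assms(1,2))
    fix k x y assume "k \<in> {(10::nat) ^ i..<10 ^ Suc i}" "x \<in> I k" "y \<in> I k"
    then show "y - x \<le> len (10 ^ i)"
      using diam [of x k y] len_antimono [of "10 ^ i" "Suc k"] by simp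
  qed
  finally have "9 * 10 ^ i \<le> (\<Sum>k<10 ^ i. h k)" by simp
  then have "real (9 * 10 ^ i) \<le> real (\<Sum>k<10 ^ i. h k)" by (rule of_nat_mono)
  also have "\<dots> \<le> (2 + 1/11) * 10 ^ i + (2 + 1/11) * 10 ^ i"
    unfolding h_def of_nat_sum of_nat_add sum.distrib
    by (intro add_mono sum_hits_early assms)
  \<comment> \<open>The early intervals supply at most 46/11 times \<open>10 ^ i\<close>, but 9
    times is needed.\<close>
  finally show False by simp
qed

section \<open>Branches and coverings\<close>

lemma branch_point:
  assumes root: "P s0"
    and step: "\<And>s. P s \<Longrightarrow> \<exists>l>s. P l \<and> node p c l \<subseteq> node p c s"
  shows "\<exists>(f :: nat \<Rightarrow> nat) x. strict_mono f \<and> (\<forall>n. P (f n) \<and> x \<in> node p c (f n))"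
proof -
  have "\<exists>f. \<forall>n. P (f n) \<and> (f n < f (Suc n) \<and> node p c (f (Suc n)) \<subseteq> node p c (f n))"
  proof (rule dependent_nat_choice [of "\<lambda>_. P" "\<lambda>_ s l. s < l \<and> node p c l \<subseteq> node p c s"])
    show "\<exists>s. P s" using root by blast
    show "\<exists>l. P l \<and> s < l \<and> node p c l \<subseteq> node p c s" if "P s" for s and n :: nat
      using step [OF that] by blast
  qed
  then obtain f where f: "\<And>n. P (f n)" "\<And>n. f n < f (Suc n)"
      "\<And>n. node p c (f (Suc n)) \<subseteq> node p c (f n)"
    by auto
  have "(\<Inter>n. node p c (f n)) \<noteq> {}"
  proof (rule compact_nest)
    show "compact (node p c (f n))" "node p c (f n) \<noteq> {}" for n
      using len_pos [of "f n"] by (simp_all add: node_def)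
    show "node p c (f n) \<subseteq> node p c (f m)" if "m \<le> n" for m n
      using that by (rule lift_Suc_antimono_le [of "\<lambda>n. node p c (f n)", OF f(3)])
  qed
  then obtain x where "\<And>n. x \<in> node p c (f n)" by auto
  moreover have "strict_mono f" using f(2) by (simp add: strict_mono_Suc_iff)
  ultimately show ?thesis using f(1) by blast
qed

lemma branches_not_covered:
  assumes "avoids I p c 0"
    and "\<And>s. avoids I p c s \<Longrightarrow> \<exists>l>s. avoids I p c l \<and> node p c l \<subseteq> node p c s"
  shows "\<not> branches p c \<subseteq> (\<Union>k. I k)"
proof -
  have "\<exists>(f :: nat \<Rightarrow> nat) x. strict_mono f \<and> (\<forall>n. avoids I p c (f n) \<and> x \<in> node p c (f n))"
    by (rule branch_point [of "avoids I p c", OF assms(1)]) (rule assms(2))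
  then obtain f :: "nat \<Rightarrow> nat" and x
    where f: "strict_mono f" "\<And>n. avoids I p c (f n)" "\<And>n. x \<in> node p c (f n)"
    by blast
  have less: "m < f (Suc m)" for m
    using seq_suble [OF f(1), of "Suc m"] by (rule Suc_le_lessD)
  have "\<exists>l>m. x \<in> node p c l" for m
    by (intro exI [of _ "f (Suc m)"] conjI less f(3))
  then have "x \<in> branches p c"
    unfolding branches_def INFM_nat by blast
  moreover have "x \<notin> I k" for k
  proof -
    \<comment> \<open>The shift to \<open>Suc k\<close> makes the index strictly larger than
      \<open>k\<close>, so that \<open>I k\<close> is among the avoided intervals.\<close>
    have "node p c (f (Suc k)) \<inter> I k = {}"
      using f(2) [of "Suc k"] less [of k] unfolding avoids_def by simp
    then show ?thesis using f(3) [of "Suc k"] by blast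
  qed
  ultimately show ?thesis by blast
qed

text \<open>Each tail of the nodes covers the set. Once \<open>len m\<close> is at most \<epsilon>,
  \<open>len (m + k) = len m ^ 2 ^ k\<close> gives the bounds.\<close>

lemma nanoscopic_branches: "nanoscopic (branches p c)"
  unfolding nanoscopic_def
proof (intro allI impI)
  fix \<epsilon> :: real assume "\<epsilon> > 0"
  obtain m where m: "(1/100) ^ m < \<epsilon>"
    using real_arch_pow_inv [OF \<open>\<epsilon> > 0\<close>, of "1/100"] by force
  have "len m \<le> (1/100) ^ m"
    unfolding len_def using less_imp_le [OF less_exp [of m]] by (intro power_decreasing) simp_all
  with m have m': "len m \<le> \<epsilon>" by simp
  show "\<exists>I. (\<forall>k. is_interval (I k)) \<and> branches p c \<subseteq> (\<Union>k. I k) \<and>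
            (\<forall>k. interval_length (I k) \<le> ennreal (\<epsilon> ^ (2 ^ k)))"
  proof (intro exI [of _ "\<lambda>k. node p c (m + k)"] conjI allI subsetI)
    fix x assume "x \<in> branches p c"
    then obtain l where "l \<ge> m" "x \<in> node p c l"
      unfolding branches_def INFM_nat_le by blast
    then have "x \<in> node p c (m + (l - m))" by simp
    then show "x \<in> (\<Union>k. node p c (m + k))" by blast
  next
    fix k
    show "is_interval (node p c (m + k))" unfolding node_def by (rule is_interval_cc)
    have "len (m + k) = len m ^ (2 ^ k)"
      unfolding len_def power_add by (rule power_mult)
    also have "\<dots> \<le> \<epsilon> ^ (2 ^ k)"
      using m' len_pos [of m] by (intro power_mono) auto
    finally show "interval_length (node p c (m + k)) \<le> ennreal (\<epsilon> ^ (2 ^ k))"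
      using len_pos [of "m + k"] by (simp add: interval_length_def node_def ennreal_leI)
  qed
qed

section \<open>The union is not nanoscopic\<close>

lemma interval_diff_le:
  assumes "is_interval J" "interval_length J \<le> ennreal d" "d \<ge> 0" "x \<in> J" "y \<in> J"
  shows "y - x \<le> d"
proof (cases "x \<le> y")
  case True
  have "{x..y} \<subseteq> J"
    using mem_is_interval_1_I [OF assms(1,4,5)] by auto
  then have "emeasure lborel {x..y} \<le> emeasure lborel J"
    using real_interval_borel_measurable [OF assms(1)] by (intro emeasure_mono) auto
  with True assms(2) have "ennreal (y - x) \<le> ennreal d"
    by (simp add: interval_length_def)
  with assms(3) show ?thesis by simp
qed (use assms(3) in simp)

lemma union_not_nanoscopic:
  assumes pq: "\<And>i. p i \<le> i" "\<And>i. q i \<le> i"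
    and pairs: "\<And>s t. \<exists>i. p i = s \<and> q i = t"
  shows "\<not> nanoscopic (branches p 0 \<union> branches q 10)"
proof
  assume nano: "nanoscopic (branches p 0 \<union> branches q 10)"
  \<comment> \<open>With \<epsilon> = \<open>len 1\<close> the k-th bound is
    \<open>len (Suc k)\<close>, one level shorter than node \<open>k\<close>.\<close>
  then have "\<exists>I. (\<forall>k. is_interval (I k)) \<and> branches p 0 \<union> branches q 10 \<subseteq> (\<Union>k. I k) \<and>
      (\<forall>k. interval_length (I k) \<le> ennreal (len 1 ^ (2 ^ k)))"
    unfolding nanoscopic_def using len_pos by (elim allE impE) auto
  then obtain I where I: "\<And>k. is_interval (I k)"
      "branches p 0 \<union> branches q 10 \<subseteq> (\<Union>k. I k)"
      "\<And>k. interval_length (I k) \<le> ennreal (len 1 ^ (2 ^ k))"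
    by (elim exE conjE) (rule that, auto)
  have "len 1 ^ (2 ^ k) = len (Suc k)" for k
    unfolding len_def by (simp flip: power_mult)
  then have diam: "y - x \<le> len (Suc k)" if "x \<in> I k" "y \<in> I k" for k x y
    using interval_diff_le [OF I(1) I(3) _ that] len_pos [of "Suc k"] by simp
  have child: "(\<exists>l>s. avoids I p 0 l \<and> node p 0 l \<subseteq> node p 0 s) \<or>
      (\<exists>l>t. avoids I q 10 l \<and> node q 10 l \<subseteq> node q 10 t)"
    if "avoids I p 0 s" "avoids I q 10 t" for s t
  proof -
    obtain i where i: "p i = s" "q i = t" using pairs by blast
    have "\<exists>l\<in>{10 ^ i..<10 ^ Suc i}. avoids I p 0 l \<or> avoids I q 10 l"
      by (rule avoiding_child) (simp_all add: pq i that diam)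
    then obtain l where l: "l \<in> {10 ^ i..<10 ^ Suc i}" "avoids I p 0 l \<or> avoids I q 10 l"
      by blast
    have "i < l" using l(1) less_pow10 [of i] by auto
    then have "s < l" "t < l" using pq [of i] by (simp_all add: i)
    moreover have "node p 0 l \<subseteq> node p 0 s" "node q 10 l \<subseteq> node q 10 t"
      using node_child_subset [of p i, OF pq(1) l(1)] node_child_subset [of q i, OF pq(2) l(1)]
      by (simp_all add: i)
    ultimately show ?thesis using l(2) by blast
  qed
  have root: "avoids I p 0 0" "avoids I q 10 0" by (simp_all add: avoids_def)
  show False
  proof (cases "\<forall>s. avoids I p 0 s \<longrightarrow> (\<exists>l>s. avoids I p 0 l \<and> node p 0 l \<subseteq> node p 0 s)")
    case True
    then have "\<not> branches p 0 \<subseteq> (\<Union>k. I k)"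
      using root(1) by (intro branches_not_covered) simp_all
    with I(2) show False by simp
  next
    case False
    then obtain s where "avoids I p 0 s" "\<not> (\<exists>l>s. avoids I p 0 l \<and> node p 0 l \<subseteq> node p 0 s)"
      by blast
    \<comment> \<open>\<open>child\<close> treats every pair, so one \<open>s\<close> without
      continuation forces every avoiding \<open>t\<close> to have one.\<close>
    with child have "\<exists>l>t. avoids I q 10 l \<and> node q 10 l \<subseteq> node q 10 t" if "avoids I q 10 t" for t
      using that by blast
    then have "\<not> branches q 10 \<subseteq> (\<Union>k. I k)"
      using root(2) by (intro branches_not_covered)
    with I(2) show False by simp
  qed
qed

theorem theorem3p6:
  "\<not> ideal_of_sets {M. nanoscopic M} \<and>
   (\<exists>A B :: real set. nanoscopic A \<and> nanoscopic B \<and> \<not> nanoscopic (A \<union> B))"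
proof -
  \<comment> \<open>Components of the Cantor pairing never exceed the code, so parents precede their
    block; by surjectivity every pair is served.\<close>
  define p where "p i = fst (prod_decode i)" for i
  define q where "q i = snd (prod_decode i)" for i
  have encode: "prod_encode (p i, q i) = i" for i
    unfolding p_def q_def prod.collapse by (rule prod_decode_inverse)
  have "p i \<le> i" for i
    using le_prod_encode_1 [of "p i" "q i"] by (simp only: encode)
  moreover have "q i \<le> i" for i
    using le_prod_encode_2 [of "q i" "p i"] by (simp only: encode)
  moreover have "\<exists>i. p i = s \<and> q i = t" for s t
    by (rule exI [of _ "prod_encode (s, t)"]) (simp add: p_def q_def)
  ultimately have "\<not> nanoscopic (branches p 0 \<union> branches q 10)"
    by (rule union_not_nanoscopic)
  with nanoscopic_branches [of p 0] nanoscopic_branches [of q 10]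
  have "\<exists>A B :: real set. nanoscopic A \<and> nanoscopic B \<and> \<not> nanoscopic (A \<union> B)"
    by (intro exI conjI)
  then show ?thesis unfolding ideal_of_sets_def mem_Collect_eq by blast
qed

end
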